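(* Let $q$ be a power of an odd prime and let $A,B\in\mathbb{F}_q$. Consider $f_{A,B}(x)=x\left(x^{q^2}+Ax^{q}+B\right)\in\mathbb{F}_{q^3}[x]$. Then $f_{A,B}$ is planar on $\mathbb{F}_{q^3}$ if and only if one of the following conditions holds: (i) $A^3-2AB+1=0$ and $A^3\neq \pm 1$; (ii) $A=B^2$ and $B^3\neq 1$; (iii) $B=0$ and $A^3+1\neq 0$.
   Context: A function $f:\mathbb{F}_{q^n}\to\mathbb{F}_{q^n}$ is called planar if for every $a\in\mathbb{F}_{q^n}^*=\mathbb{F}_{q^n}\setminus\{0\}$ the difference function $D_{f,a}(x)=f(x+a)-f(x)$ is a permutation of $\mathbb{F}_{q^n}$.
   Formalization: The polynomial is taken as f_{A,B}(x) = x(x^{q^2}+Ax^q+Bx), with Bx in place of the printed constant B; as printed the claim fails, e.g. q=3, A=0, B=1, where x(x^9+1) is planar on F_27 but (i)-(iii) all fail. *)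

theory Defs
  imports "HOL-Computational_Algebra.Primes" "HOL-Computational_Algebra.Polynomial"
begin

definition planar :: "('a::field \<Rightarrow> 'a) \<Rightarrow> bool" where
  "planar f \<longleftrightarrow> (\<forall>a. a \<noteq> 0 \<longrightarrow> bij (\<lambda>x. f (x + a) - f x))"

definition is_subfield :: "'a::field set \<Rightarrow> bool" where
  "is_subfield K \<longleftrightarrow>
     0 \<in> K \<and> 1 \<in> K \<and>
     (\<forall>x\<in>K. \<forall>y\<in>K. x + y \<in> K \<and> x * y \<in> K) \<and>
     (\<forall>x\<in>K. - x \<in> K \<and> inverse x \<in> K)"

(* The polynomial x (x^(q^2) + A x^q + B x).  The inner factor is a q-linearized polynomial,
   so its last term is B x and not the constant B: with a constant, B would contribute only
   an additive constant to every difference function, and planarity would not depend on B. *)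
definition f_AB :: "nat \<Rightarrow> 'a::field \<Rightarrow> 'a \<Rightarrow> 'a poly" where
  "f_AB q A B = monom 1 1 * (monom 1 (q ^ 2) + monom A q + monom B 1)"

end

(* Since f is a Dembowski-Ostrom polynomial, it is planar iff x L(y) + y L(x) has no zero with
   x, y nonzero, where f(x) = x L(x); that is, iff no c is an eigenvalue of L together with -c.
   By the Dickson determinant this means that no c in F_{q^3} satisfies
     B e2 + B^3 + A^3 + 1 - 3AB = 0  and  e3 + (B^2 - A) e1 = 0
   for the elementary symmetric functions e1, e2, e3 of c, c^q, c^{q^2}.  Sufficiency of the three
   conditions can be read off from these equations.

   Otherwise put m = B^2 - A, so that e2 = -E and e3 = -m e1 for some E in F_q different from m.
   Each value s of e1 gives a cubic over F_q with parameter s, and a solution c exists unless all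
   these cubics have a root in F_q.  Then the degree 3 function (T^3 - ET)/(T^2 - m) maps F_q onto
   F_q, so it is injective and m is a nonsquare.  Hence the discriminants of the cubics are all
   nonsquares.  But the discriminant is Q(s^2) with Q quadratic with leading coefficient 4m, and
   the conic z^2 = Q(w) has too many points for them all to lie over nonsquares w. *)

theory Submission
  imports "HOL-Algebra.Algebraic_Closure_Type" "HOL-Number_Theory.Residues" Defs
begin

section \<open>Finite subfields and their algebraic closure\<close>

lemma is_subfield_UNIV: "is_subfield (UNIV :: 'a::field set)"
  by (simp add: is_subfield_def)

lemma subfield_power_card:
  fixes K :: "'a::field set"
  assumes K: "is_subfield K" and fin: "finite K" and x: "x \<in> K"
  shows "x ^ card K = x"
proof (cases "x = 0")
  case True
  have "card K \<noteq> 0" using fin x by auto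
  thus ?thesis using True by simp
next
  case False
  let ?S = "K - {0}"
  have inv: "inverse x \<in> K" using K x by (simp add: is_subfield_def)
  have "(\<Prod>y\<in>?S. x * y) = (\<Prod>y\<in>?S. y)"
  proof (rule prod.reindex_bij_witness[of _ "\<lambda>y. inverse x * y" "\<lambda>y. x * y"])
  qed (use False x inv K in \<open>auto simp: is_subfield_def\<close>)
  moreover have "(\<Prod>y\<in>?S. x * y) = x ^ card ?S * (\<Prod>y\<in>?S. y)"
    by (simp add: prod.distrib)
  moreover have "(\<Prod>y\<in>?S. y) \<noteq> 0" using fin by simp
  ultimately have one: "x ^ card ?S = 1" by simp
  have "0 \<in> K" using K by (simp add: is_subfield_def)
  hence "card K = Suc (card ?S)" using fin by (metis card_Suc_Diff1)
  thus ?thesis using one by simp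
qed

lemma card_power_fixed_le:
  assumes "n \<ge> 2"
  shows "finite {x :: 'a::field. x ^ n = x}" and "card {x :: 'a::field. x ^ n = x} \<le> n"
proof -
  let ?P = "monom 1 n - monom 1 1 :: 'a poly"
  have deg: "degree ?P = n"
    using assms by (subst diff_conv_add_uminus, subst degree_add_eq_left) (simp_all add: degree_monom_eq)
  hence nz: "?P \<noteq> 0" using assms by auto
  have eq: "{x. poly ?P x = 0} = {x. x ^ n = x}" by (simp add: poly_monom)
  show "finite {x :: 'a. x ^ n = x}" "card {x :: 'a. x ^ n = x} \<le> n"
    using card_poly_roots_bound[OF nz] poly_roots_finite[OF nz] deg unfolding eq by simp_all
qed

text \<open>Root counting: every element of \<open>K\<close> is a root of X^n - X with n =
  \<open>card K\<close>, and this polynomial has at most n roots. Membership in F_q thereby becomes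
  a Frobenius equation.\<close>

lemma subfield_eq_power_fixed:
  fixes K :: "'a::field set"
  assumes "is_subfield K" and "finite K"
  shows "K = {x. x ^ card K = x}"
proof (rule card_seteq)
  have "{0, 1} \<subseteq> K" using assms(1) by (simp add: is_subfield_def)
  from card_mono[OF assms(2) this] have n: "card K \<ge> 2" by simp
  show "finite {x::'a. x ^ card K = x}" "card {x::'a. x ^ card K = x} \<le> card K"
    using card_power_fixed_le[OF n] by auto
  show "K \<subseteq> {x. x ^ card K = x}" using subfield_power_card[OF assms] by auto
qed

lemma subfield_closed:
  assumes "is_subfield K"
  shows "0 \<in> K" "1 \<in> K" "\<And>x y. x \<in> K \<Longrightarrow> y \<in> K \<Longrightarrow> x + y \<in> K"
    "\<And>x y. x \<in> K \<Longrightarrow> y \<in> K \<Longrightarrow> x * y \<in> K" "\<And>x. x \<in> K \<Longrightarrow> - x \<in> K"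
    "\<And>x. x \<in> K \<Longrightarrow> inverse x \<in> K" "\<And>x y. x \<in> K \<Longrightarrow> y \<in> K \<Longrightarrow> x - y \<in> K"
    "\<And>x y. x \<in> K \<Longrightarrow> y \<in> K \<Longrightarrow> x / y \<in> K" "\<And>x n. x \<in> K \<Longrightarrow> x ^ n \<in> K"
    "numeral m \<in> K"
proof -
  show a: "0 \<in> K" "1 \<in> K" "\<And>x y. x \<in> K \<Longrightarrow> y \<in> K \<Longrightarrow> x + y \<in> K"
    "\<And>x y. x \<in> K \<Longrightarrow> y \<in> K \<Longrightarrow> x * y \<in> K" "\<And>x. x \<in> K \<Longrightarrow> - x \<in> K"
    "\<And>x. x \<in> K \<Longrightarrow> inverse x \<in> K" 
    using assms by (auto simp: is_subfield_def)
  show "\<And>x y. x \<in> K \<Longrightarrow> y \<in> K \<Longrightarrow> x - y \<in> K" using a by (metis diff_conv_add_uminus)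
  show "\<And>x y. x \<in> K \<Longrightarrow> y \<in> K \<Longrightarrow> x / y \<in> K" using a by (metis divide_inverse)
  show "x ^ n \<in> K" if "x \<in> K" for x n by (induction n) (use a that in auto)
  show "numeral m \<in> K" by (induction m) (simp_all only: numeral.simps a)
qed

text \<open>The same root count inside the algebraic closure. It brings elements built there back
  into \<open>K\<close>.\<close>

lemma power_fixed_alg_closure:
  fixes K :: "'a::field set"
  assumes K: "is_subfield K" and fin: "finite K"
  shows "{y :: 'a alg_closure. y ^ card K = y} = to_ac ` K"
proof (rule card_seteq[symmetric])
  have "{0, 1} \<subseteq> K" using K by (simp add: is_subfield_def)
  from card_mono[OF fin this] have n: "card K \<ge> 2" by simp
  show "finite {y :: 'a alg_closure. y ^ card K = y}" by (rule card_power_fixed_le[OF n])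
  show "to_ac ` K \<subseteq> {y. y ^ card K = y}"
    using subfield_power_card[OF K fin] by (auto simp flip: to_ac_power)
  have "card (to_ac ` K) = card K"
    by (rule card_image) (auto simp: inj_on_def)
  thus "card {y :: 'a alg_closure. y ^ card K = y} \<le> card (to_ac ` K)"
    using card_power_fixed_le(2)[OF n, where ?'a = "'a alg_closure"] by simp
qed

text \<open>Vieta from two distinct roots: subtracting the two equations and cancelling
  \<open>x - y\<close> gives \<open>c\<close>, and then \<open>d\<close>. No splitting of the cubic
  has to be known beforehand.\<close>

lemma cubic_two_roots:
  fixes x y :: "'b::idom"
  assumes x: "x ^ 3 + b * x\<^sup>2 + c * x + d = 0" and y: "y ^ 3 + b * y\<^sup>2 + c * y + d = 0"
    and neq: "x \<noteq> y" and z: "x + y + z = - b"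
  shows "c = x * y + y * z + z * x" and "d = - (x * y * z)"
    and "t ^ 3 + b * t\<^sup>2 + c * t + d = (t - x) * (t - y) * (t - z)"
proof -
  have b: "b = - (x + y + z)" using z by simp
  have "(x - y) * (c - (x * y + y * z + z * x)) =
      (x ^ 3 + b * x\<^sup>2 + c * x + d) - (y ^ 3 + b * y\<^sup>2 + c * y + d)"
    unfolding b by (simp add: algebra_simps power3_eq_cube power2_eq_square)
  also have "\<dots> = 0" using x y by simp
  finally show c: "c = x * y + y * z + z * x" using neq by simp
  show d: "d = - (x * y * z)"
    using x unfolding b c by (simp add: algebra_simps power3_eq_cube power2_eq_square eq_neg_iff_add_eq_0)
  show "t ^ 3 + b * t\<^sup>2 + c * t + d = (t - x) * (t - y) * (t - z)"
    unfolding b c d by (simp add: algebra_simps power3_eq_cube power2_eq_square)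
qed

section \<open>Points on conics\<close>

lemma card_square_roots_le: "card {x::'a::idom. x\<^sup>2 = y} \<le> 2" "finite {x::'a::idom. x\<^sup>2 = y}"
proof -
  have "\<exists>r. {x::'a. x\<^sup>2 = y} \<subseteq> {r, - r}"
  proof (cases "\<exists>r::'a. r\<^sup>2 = y")
    case True
    thus ?thesis by (auto simp: power2_eq_iff)
  qed auto
  then obtain r where r: "{x::'a. x\<^sup>2 = y} \<subseteq> {r, - r}" by blast
  thus "finite {x::'a. x\<^sup>2 = y}" by (rule finite_subset) simp
  from card_mono[OF _ r] show "card {x::'a. x\<^sup>2 = y} \<le> 2"
    using card_insert_le_m1[of 2 "{- r}" r] by simp
qed

text \<open>Squaring is at most two-to-one on nonzero elements, and 0 is a square of its own; this
  accounts for the summand 1.\<close>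

lemma card_squares_ge:
  fixes K :: "'a::field set"
  assumes K: "is_subfield K" and fin: "finite K"
  shows "card K + 1 \<le> 2 * card (power2 ` K)"
proof -
  let ?S = "power2 ` K"
  have 0: "0 \<in> K" "0 \<in> ?S" using subfield_closed[OF K] by (auto intro!: image_eqI[of _ _ 0])
  have "K - {0} \<subseteq> (\<Union>y\<in>?S - {0}. {x. x\<^sup>2 = y})" by auto
  hence "card (K - {0}) \<le> card (\<Union>y\<in>?S - {0}. {x::'a. x\<^sup>2 = y})"
    by (rule card_mono[rotated]) (use fin card_square_roots_le in auto)
  also have "\<dots> \<le> (\<Sum>y\<in>?S - {0}. card {x::'a. x\<^sup>2 = y})"
    by (rule card_UN_le) (use fin in auto)
  also have "\<dots> \<le> (\<Sum>y\<in>?S - {0}. 2)" by (rule sum_mono) (rule card_square_roots_le)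
  also have "\<dots> = 2 * card (?S - {0})" by simp
  finally have "card (K - {0}) \<le> 2 * card (?S - {0})" .
  moreover have "card K = Suc (card (K - {0}))" "card ?S = Suc (card (?S - {0}))"
    using card_Suc_Diff1[OF fin 0(1)] card_Suc_Diff1[OF finite_imageI[OF fin] 0(2)] by simp_all
  ultimately show ?thesis by simp
qed

text \<open>Pigeonhole: the values u^2 and the values d + m v^2 each fill more than half of
  \<open>K\<close>, so they meet.\<close>

lemma ex_norm_form_eq:
  fixes K :: "'a::field set"
  assumes K: "is_subfield K" and fin: "finite K" and m: "m \<in> K" "m \<noteq> 0" and d: "d \<in> K"
  shows "\<exists>u\<in>K. \<exists>v\<in>K. u\<^sup>2 - m * v\<^sup>2 = d"
proof -
  let ?S = "power2 ` K" and ?T = "(\<lambda>s. d + m * s) ` power2 ` K"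
  note cl = subfield_closed[OF K]
  have "inj_on (\<lambda>s. d + m * s) (power2 ` K)" using m by (auto simp: inj_on_def)
  hence "card ?T = card ?S" by (rule card_image)
  hence "card K < card ?S + card ?T" using card_squares_ge[OF K fin] by simp
  moreover have "?S \<union> ?T \<subseteq> K" using m d cl by auto
  hence "card (?S \<union> ?T) \<le> card K" by (rule card_mono[OF fin])
  ultimately have "?S \<inter> ?T \<noteq> {}" using card_Un_disjoint[of ?S ?T] fin by fastforce
  thus ?thesis by (auto simp: algebra_simps)
qed

text \<open>For a nonsquare \<open>m\<close> the form is the norm from K(sqrt m), so one solution
  yields others through norm-one elements. The parametrization by \<open>t\<close> in
  \<open>K\<close> omits only the norm-one element 1 (t at infinity).\<close>

lemma card_norm_form_ge:
  fixes K :: "'a::field set"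
  assumes K: "is_subfield K" and fin: "finite K" and two: "(2::'a) \<noteq> 0"
    and m: "m \<in> K" "\<And>x. x \<in> K \<Longrightarrow> x\<^sup>2 \<noteq> m" and d: "d \<in> K" "d \<noteq> 0"
  shows "card K \<le> card {(u, v) \<in> K \<times> K. u\<^sup>2 - m * v\<^sup>2 = d}" (is "_ \<le> card ?N")
proof -
  note cl = subfield_closed[OF K]
  have m0: "m \<noteq> 0" using m(2)[of 0] cl by auto
  obtain u0 v0 where uv: "u0 \<in> K" "v0 \<in> K" "u0\<^sup>2 - m * v0\<^sup>2 = d"
    using ex_norm_form_eq[OF K fin m(1) m0 d(1)] by blast
  \<comment> \<open>multiply the solution $u_0 + v_0\sqrt m$ by the norm-one elements $(t + \sqrt m)/(t - \sqrt m)$\<close>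
  define a where "a t = (t\<^sup>2 + m) / (t\<^sup>2 - m)" for t
  define b where "b t = 2 * t / (t\<^sup>2 - m)" for t
  define f where "f t = (u0 * a t + m * v0 * b t, u0 * b t + v0 * a t)" for t
  \<comment> \<open>The left inverse of \<open>f\<close>: multiplying by the conjugate of u0 + v0
    sqrt m and dividing by \<open>d\<close> recovers \<open>a t\<close> and \<open>b t\<close>, and
    then t = m b / (a - 1).\<close>
  define g where "g = (\<lambda>(u, v). m * ((u0 * v - v0 * u) / d) / ((u0 * u - m * v0 * v) / d - 1))"
  have nz: "t\<^sup>2 - m \<noteq> 0" if "t \<in> K" for t using m(2)[OF that] by simp
  have ab: "(a t)\<^sup>2 - m * (b t)\<^sup>2 = 1" if "t \<in> K" for t
  proof -
    have "(t\<^sup>2 + m)\<^sup>2 - m * (2 * t)\<^sup>2 = (t\<^sup>2 - m)\<^sup>2"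
      by (simp add: power2_eq_square algebra_simps)
    thus ?thesis using nz[OF that] 
      by (simp add: a_def b_def power_divide flip: diff_divide_distrib)
  qed
  have "f ` K \<subseteq> ?N"
  proof
    fix w assume "w \<in> f ` K"
    then obtain t where t: "t \<in> K" "w = f t" by blast
    have K': "a t \<in> K" "b t \<in> K" using t(1) m(1) by (auto simp: a_def b_def intro!: cl)
    have "(u0 * a t + m * v0 * b t)\<^sup>2 - m * (u0 * b t + v0 * a t)\<^sup>2
       = (u0\<^sup>2 - m * v0\<^sup>2) * ((a t)\<^sup>2 - m * (b t)\<^sup>2)"
      by (simp add: power2_eq_square algebra_simps)
    also have "\<dots> = d" using uv ab[OF t(1)] by simp
    finally show "w \<in> ?N" using t(2) K' uv(1,2) m(1) by (auto simp: f_def intro!: cl)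
  qed
  moreover have "inj_on f K"
  proof (rule inj_on_inverseI)
    fix t assume t: "t \<in> K"
    have "u0 * (u0 * b t + v0 * a t) - v0 * (u0 * a t + m * v0 * b t) = (u0\<^sup>2 - m * v0\<^sup>2) * b t"
      "u0 * (u0 * a t + m * v0 * b t) - m * v0 * (u0 * b t + v0 * a t) = (u0\<^sup>2 - m * v0\<^sup>2) * a t"
      by (simp_all add: power2_eq_square algebra_simps)
    hence "g (f t) = m * b t / (a t - 1)" using d(2) by (simp add: g_def f_def uv(3))
    also have "a t - 1 = 2 * m / (t\<^sup>2 - m)" using nz[OF t] by (simp add: a_def field_simps)
    also have "m * b t / (2 * m / (t\<^sup>2 - m)) = t" using nz[OF t] m0 two by (simp add: b_def)
    finally show "g (f t) = t" .
  qed
  moreover have "finite ?N" by (rule finite_subset[of _ "K \<times> K"]) (use fin in auto)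
  ultimately show ?thesis using card_mono[of ?N "f ` K"] by (simp add: card_image)
qed

text \<open>Completing the square turns z^2 = 4 m w^2 + \<beta> w + \<gamma> into a norm equation
  with at least \<open>card K\<close> solutions. If every w occurring were a nonsquare, there would
  be at most twice as many points as nonsquares, hence at most \<open>card K - 1\<close>.\<close>

lemma ex_biquadratic_square:
  fixes K :: "'a::field set"
  assumes K: "is_subfield K" and fin: "finite K" and two: "(2::'a) \<noteq> 0"
    and m: "m \<in> K" "\<And>x. x \<in> K \<Longrightarrow> x\<^sup>2 \<noteq> m" and bg: "\<beta> \<in> K" "\<gamma> \<in> K"
    and disc: "\<beta>\<^sup>2 \<noteq> 16 * m * \<gamma>"
  shows "\<exists>s\<in>K. \<exists>z\<in>K. z\<^sup>2 = 4 * m * s ^ 4 + \<beta> * s\<^sup>2 + \<gamma>"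
proof (rule ccontr)
  assume "\<not> ?thesis"
  hence non: "z\<^sup>2 \<noteq> 4 * m * s ^ 4 + \<beta> * s\<^sup>2 + \<gamma>" if "s \<in> K" "z \<in> K" for s z
    using that by blast
  note cl = subfield_closed[OF K]
  have m0: "m \<noteq> 0" using m(2)[of 0] cl by auto
  have four: "(4::'a) = 2 * 2" "(8::'a) = 2 * 2 * 2" "(16::'a) = 2 * 2 * 2 * 2" by simp_all
  have n48: "(4::'a) \<noteq> 0" "(8::'a) \<noteq> 0" "(16::'a) \<noteq> 0" unfolding four by (intro no_zero_divisors two)+
  let ?d = "\<beta>\<^sup>2 - 16 * m * \<gamma>"
  let ?S = "power2 ` K"
  let ?N = "{(u, v) \<in> K \<times> K. u\<^sup>2 - m * v\<^sup>2 = ?d}"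
  let ?G = "Sigma (K - ?S) (\<lambda>w. {z. z\<^sup>2 = 4 * m * w\<^sup>2 + \<beta> * w + \<gamma>})"
  \<comment> \<open>Inverse of the substitution u = 8 m w + \<beta>, v = 4 z that completes the
    square.\<close>
  define h where "h = (\<lambda>(u, v :: 'a). ((u - \<beta>) / (8 * m), v / 4))"
  have "card K \<le> card ?N"
    by (rule card_norm_form_ge[OF K fin two m]) (use disc bg m in \<open>auto intro!: cl\<close>)
  also have "card ?N = card (h ` ?N)"
    by (rule card_image[symmetric]) (use m0 n48 in \<open>auto simp: inj_on_def h_def\<close>)
  also have "card (h ` ?N) \<le> card ?G"
  proof (rule card_mono)
    show "finite ?G" using fin card_square_roots_le by auto
    show "h ` ?N \<subseteq> ?G"
    proof
      fix r assume "r \<in> h ` ?N"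
      then obtain u v where uv: "u \<in> K" "v \<in> K" "u\<^sup>2 - m * v\<^sup>2 = ?d" "r = h (u, v)" by auto
      define w z where wz: "w = (u - \<beta>) / (8 * m)" "z = v / 4"
      have wK: "w \<in> K" "z \<in> K" using uv m bg by (auto simp: wz intro!: cl)
      have u: "u = 8 * m * w + \<beta>" and v: "v = 4 * z" using m0 n48 by (simp_all add: wz)
      have "(4 * 4 * m) * (z\<^sup>2 - (4 * m * w\<^sup>2 + \<beta> * w + \<gamma>)) = ?d - (u\<^sup>2 - m * v\<^sup>2)"
        unfolding u v by (simp add: power2_eq_square algebra_simps)
      also have "\<dots> = 0" using uv(3) by simp
      finally have Q: "z\<^sup>2 = 4 * m * w\<^sup>2 + \<beta> * w + \<gamma>" using n48 m0 by simp
      have "w \<notin> ?S"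
      proof
        assume "w \<in> ?S"
        then obtain s where "s \<in> K" "w = s\<^sup>2" by blast
        with Q non[of s z] wK show False by (simp flip: power_mult)
      qed
      thus "r \<in> ?G" using Q wK uv(4) by (simp add: h_def wz)
    qed
  qed
  also have "card ?G = (\<Sum>w\<in>K - ?S. card {z. z\<^sup>2 = 4 * m * w\<^sup>2 + \<beta> * w + \<gamma>})"
    by (rule card_SigmaI) (use fin card_square_roots_le in auto)
  also have "\<dots> \<le> (\<Sum>w\<in>K - ?S. 2)" by (rule sum_mono) (rule card_square_roots_le)
  also have "\<dots> = 2 * (card K - card ?S)" 
  proof -
    have "?S \<subseteq> K" using cl by auto
    thus ?thesis using fin by (simp add: card_Diff_subset)
  qed
  finally have "card K \<le> 2 * (card K - card ?S)" .
  moreover have "card K > 0" using fin cl(1) by (auto simp: card_gt_0_iff)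
  ultimately show False using card_squares_ge[OF K fin] by linarith
qed

section \<open>Planarity and eigenvalues\<close>

text \<open>Up to the constant \<open>a * L a\<close>, the difference function in direction
  \<open>a\<close> is additive in x. On a finite field it is therefore bijective exactly when its
  kernel is trivial.\<close>

lemma planar_mult_additive_iff:
  fixes L :: "'a::{finite, field} \<Rightarrow> 'a"
  assumes add: "\<And>x y. L (x + y) = L x + L y"
  shows "planar (\<lambda>x. x * L x) \<longleftrightarrow> (\<forall>x y. x \<noteq> 0 \<longrightarrow> y \<noteq> 0 \<longrightarrow> x * L y + y * L x \<noteq> 0)"
proof -
  have L0: "L 0 = 0" using add[of 0 0] by (metis add_cancel_right_left)
  have Ldiff: "L (x - y) = L x - L y" for x y using add[of "x - y" y] by simp
  have D: "(x + a) * L (x + a) - x * L x = a * L x + x * L a + a * L a" for x a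
    by (simp add: add algebra_simps)
  have "bij (\<lambda>x. (x + a) * L (x + a) - x * L x) \<longleftrightarrow> (\<forall>x. x \<noteq> 0 \<longrightarrow> x * L a + a * L x \<noteq> 0)"
    for a
  proof -
    let ?g = "\<lambda>x. (x + a) * L (x + a) - x * L x"
    have "bij ?g \<longleftrightarrow> inj ?g"
      using finite_UNIV_inj_surj[of ?g] by (auto simp: bij_def)
    also have "\<dots> \<longleftrightarrow> (\<forall>x. x \<noteq> 0 \<longrightarrow> x * L a + a * L x \<noteq> 0)"
    proof
      assume i: "inj ?g"
      show "\<forall>x. x \<noteq> 0 \<longrightarrow> x * L a + a * L x \<noteq> 0"
      proof (intro allI impI notI)
        fix x assume "x \<noteq> 0" "x * L a + a * L x = 0"
        hence "?g x = ?g 0" unfolding D by (simp add: L0 algebra_simps)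
        with \<open>x \<noteq> 0\<close> show False using injD[OF i, of x 0] by blast
      qed
    next
      assume h: "\<forall>x. x \<noteq> 0 \<longrightarrow> x * L a + a * L x \<noteq> 0"
      show "inj ?g"
      proof (rule injI)
        fix x y assume "?g x = ?g y"
        hence "(x - y) * L a + a * L (x - y) = 0" unfolding D Ldiff by (simp add: algebra_simps)
        with h have "\<not> x - y \<noteq> 0" by blast
        thus "x = y" by simp
      qed
    qed
    finally show ?thesis .
  qed
  thus ?thesis unfolding planar_def by blast
qed

section \<open>The Frobenius map of F_{q^3} over F_q and its symmetric functions\<close>

locale cubic_extension =
  fixes p k q :: nat and Fq :: "'a::{finite, field} set"
  assumes prime_p: "prime p" and odd_p: "odd p" and k_pos: "k \<ge> 1" and q_def: "q = p ^ k"
    and card_UNIV: "card (UNIV :: 'a set) = q ^ 3"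
    and subfield: "is_subfield Fq" and card_Fq: "card Fq = q"
begin

lemma CHAR_eq: "CHAR('a) = p"
proof -
  have "CHAR('a) > 0" by (rule finite_imp_CHAR_pos) simp
  hence pr: "prime CHAR('a)" using prime_CHAR_semidom[where ?'a = 'a] by blast
  have "CHAR('a) dvd p ^ (k * 3)"
    using CHAR_dvd_CARD[where ?'a = 'a] by (simp add: card_UNIV q_def power_mult)
  hence "CHAR('a) dvd p" using pr prime_dvd_power by blast
  thus ?thesis using pr prime_p primes_dvd_imp_eq by blast
qed

lemma q_gt: "q \<ge> 2"
  using prime_ge_2_nat[OF prime_p] k_pos unfolding q_def
  by (metis le_trans self_le_power prime_gt_0_nat prime_p One_nat_def Suc_leI less_le_trans zero_less_one)

lemma two_nz: "(2::'a) \<noteq> 0"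
proof
  assume "(2::'a) = 0"
  hence "of_nat 2 = (0::'a)" by simp
  hence "p dvd 2" using of_nat_eq_0_iff_char_dvd[where ?'a = 'a, of 2] by (simp only: CHAR_eq)
  hence "p \<le> 2" by (auto dest: dvd_imp_le)
  with prime_ge_2_nat[OF prime_p] odd_p show False by (cases "p = 2") auto
qed

lemma frob_add: "(x + y) ^ q = x ^ q + (y::'a) ^ q"
  by (rule freshmans_dream') (simp_all add: CHAR_eq prime_p q_def)

lemma frob_minus: "(- y) ^ q = - ((y::'a) ^ q)"
proof -
  have "(- y + y) ^ q = (- y) ^ q + y ^ q" by (rule frob_add)
  thus ?thesis using q_gt by (simp add: eq_neg_iff_add_eq_0 power_0_left)
qed

lemma frob_diff: "(x - y) ^ q = x ^ q - (y::'a) ^ q"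
  using frob_add[of x "- y"] by (simp add: frob_minus)

lemma frob3: "((x ^ q) ^ q) ^ q = (x::'a)"
proof -
  have "x ^ (q ^ 3) = x" using subfield_power_card[OF is_subfield_UNIV, of x] by (simp add: card_UNIV)
  thus ?thesis by (simp add: power3_eq_cube mult_ac flip: power_mult)
qed

lemma finite_Fq: "finite Fq" by simp

lemma Fq_iff: "x \<in> Fq \<longleftrightarrow> x ^ q = x"
  using subfield_eq_power_fixed[OF subfield finite_Fq] by (auto simp: card_Fq)

lemmas frob_simps = frob_add frob_diff frob_minus frob3 power_mult_distrib

definition L :: "'a \<Rightarrow> 'a \<Rightarrow> 'a \<Rightarrow> 'a" where
  "L A B x = (x ^ q) ^ q + A * x ^ q + B * x"

text \<open>\<open>tr\<close>, \<open>tr2\<close> and \<open>nm\<close> are the elementary symmetric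
  functions e1, e2, e3 of the conjugates c, c^q, c^{q^2}.\<close>

definition tr :: "'a \<Rightarrow> 'a" where "tr c = c + c ^ q + (c ^ q) ^ q"

definition tr2 :: "'a \<Rightarrow> 'a" where
  "tr2 c = c * c ^ q + c ^ q * (c ^ q) ^ q + (c ^ q) ^ q * c"

definition nm :: "'a \<Rightarrow> 'a" where "nm c = c * c ^ q * (c ^ q) ^ q"

lemma poly_f_AB: "poly (f_AB q A B) = (\<lambda>x. x * L A B x)"
  by (rule ext) (simp add: f_AB_def L_def poly_monom power2_eq_square flip: power_mult)

lemma planar_f_AB_iff:
  "planar (poly (f_AB q A B)) \<longleftrightarrow> (\<forall>x y. x \<noteq> 0 \<longrightarrow> y \<noteq> 0 \<longrightarrow> x * L A B y + y * L A B x \<noteq> 0)"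
  unfolding poly_f_AB by (rule planar_mult_additive_iff) (simp add: L_def frob_simps algebra_simps)

text \<open>As a polynomial in \<theta> the expression is nonzero, since the exponents 1, q, q^2 are
  distinct, and its degree is below q^3, so it cannot vanish on the whole field.\<close>

lemma ex_trace_like_nonzero:
  assumes "U \<noteq> 0 \<or> V \<noteq> 0 \<or> W \<noteq> (0::'a)"
  shows "\<exists>\<theta>. U * \<theta> + W * \<theta> ^ q + V * (\<theta> ^ q) ^ q \<noteq> 0"
proof (rule ccontr)
  assume "\<not> ?thesis"
  hence z: "U * \<theta> + W * \<theta> ^ q + V * \<theta> ^ (q * q) = 0" for \<theta> by (auto simp flip: power_mult)
  define P where "P = monom U 1 + monom W q + monom V (q * q)"
  have P: "poly P \<theta> = 0" for \<theta> using z[of \<theta>] by (simp add: P_def poly_monom)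
  have qq: "q < q * q" "q * q < q ^ 3" "1 < q * q" using q_gt by (auto simp: power3_eq_cube intro: less_le_trans[of _ "2 * q"])
  have c: "coeff P 1 = U" "coeff P q = W" "coeff P (q * q) = V"
    using q_gt qq by (auto simp: P_def)
  hence nz: "P \<noteq> 0" using assms by auto
  have "degree P \<le> q * q"
    unfolding P_def
    by (intro degree_add_le order.trans[OF degree_monom_le]) (use q_gt qq in auto)
  moreover have "card {x. poly P x = 0} = q ^ 3" using P by (simp add: card_UNIV)
  ultimately show False using card_poly_roots_bound[OF nz] qq by simp
qed

text \<open>The right-hand side is the Dickson determinant of $x \mapsto L(x) - c x$.\<close>

lemma eigenvalue_iff:
  assumes A: "A \<in> Fq" and B: "B \<in> Fq"
  shows "(\<exists>x. x \<noteq> 0 \<and> L A B x = c * x) \<longleftrightarrow> nm (B - c) - A * tr (B - c) + A ^ 3 + 1 = 0"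
    (is "?lhs \<longleftrightarrow> ?rhs")
proof
  have fA: "A ^ q = A" using A by (simp add: Fq_iff)
  define w w1 w2 where w: "w = B - c" "w1 = w ^ q" "w2 = w1 ^ q"
  have w2q: "w2 ^ q = w" by (simp add: w(2,3) frob3)
  have det: "?rhs \<longleftrightarrow> w * w1 * w2 - A * (w + w1 + w2) + A ^ 3 + 1 = 0"
    by (simp add: nm_def tr_def w)
  have L: "L A B x = c * x \<longleftrightarrow> w * x + A * x ^ q + (x ^ q) ^ q = 0" for x
    by (auto simp: L_def w(1) algebra_simps)
  {
    assume ?lhs
    then obtain x where x: "x \<noteq> 0" "w * x + A * x ^ q + (x ^ q) ^ q = 0" by (auto simp: L)
    define y z where yz: "y = x ^ q" "z = y ^ q"
    have zq: "z ^ q = x" by (simp add: yz frob3)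
    have e1: "w * x + A * y + z = 0" using x(2) by (simp add: yz)
    have e2: "w1 * y + A * z + x = 0"
      using arg_cong[OF e1, of "\<lambda>t. t ^ q"] q_gt by (simp add: frob_simps fA zq power_0_left flip: yz w)
    have e3: "w2 * z + A * x + y = 0"
      using arg_cong[OF e2, of "\<lambda>t. t ^ q"] q_gt by (simp add: frob_simps fA zq power_0_left flip: yz w)
    \<comment> \<open>Cramer's rule: the multipliers are the cofactors of the first column of the
      system in x, y, z.\<close>
    have "(w * w1 * w2 - A * (w + w1 + w2) + A ^ 3 + 1) * x
      = (w1 * w2 - A) * (w * x + A * y + z) + (1 - A * w2) * (w1 * y + A * z + x)
        + (A * A - w1) * (w2 * z + A * x + y)"
      by (simp add: algebra_simps power3_eq_cube)
    hence "(w * w1 * w2 - A * (w + w1 + w2) + A ^ 3 + 1) * x = 0" by (simp only: e1 e2 e3) simp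
    thus ?rhs unfolding det using x(1) by simp
  }
  {
    assume ?rhs
    hence d: "w * w1 * w2 - A * (w + w1 + w2) + A ^ 3 + 1 = 0" by (simp add: det)
    have "\<exists>U V W. (U \<noteq> 0 \<or> V \<noteq> 0 \<or> W \<noteq> 0) \<and> w * U + A * V + W = 0 \<and>
        U + w1 * V + A * W = 0 \<and> A * U + V + w2 * W = 0"
    \<comment> \<open>The cofactors of the first row form a kernel vector unless all of them vanish.
      In that case all three rows are proportional and (0, 1, -A) serves.\<close>
    proof (cases "w1 * w2 - A = 0 \<and> A * A - w2 = 0 \<and> 1 - A * w1 = 0")
      case False
      have "w * (w1 * w2 - A) + A * (A * A - w2) + (1 - A * w1) = 0"
        using d by (simp add: algebra_simps power3_eq_cube)
      moreover have "(w1 * w2 - A) + w1 * (A * A - w2) + A * (1 - A * w1) = 0"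
        by (simp add: algebra_simps)
      moreover have "A * (w1 * w2 - A) + (A * A - w2) + w2 * (1 - A * w1) = 0"
        by (simp add: algebra_simps)
      ultimately show ?thesis using False by blast
    next
      case True
      hence w2': "w2 = A * A" by simp
      have "w = A * A" using w2q by (simp add: w2' power_mult_distrib fA)
      hence w1': "w1 = A * A" by (simp add: w power_mult_distrib fA)
      have "1 - A * w1 = 0" using True by blast
      hence A3: "A * (A * A) = 1" by (metis w1' eq_iff_diff_eq_0)
      have "w * 0 + A * 1 + - A = 0 \<and> 0 + w1 * 1 + A * - A = 0 \<and> A * 0 + 1 + w2 * - A = 0"
        using A3 by (simp add: w1' w2' mult.assoc)
      thus ?thesis using one_neq_zero by blast
    qed
    then obtain U V W where nz: "U \<noteq> 0 \<or> V \<noteq> 0 \<or> W \<noteq> 0" and e: "w * U + A * V + W = 0"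
        "U + w1 * V + A * W = 0" "A * U + V + w2 * W = 0" by blast
    \<comment> \<open>Frobenius permutes the equations cyclically, so a trace turns the kernel vector
      $(U, V, W)$ into one of the shape $(x, x^q, x^{q^2})$.\<close>
    have "U \<noteq> 0 \<or> (V ^ q) ^ q \<noteq> 0 \<or> W ^ q \<noteq> 0" using nz by auto
    then obtain \<theta> where \<theta>: "U * \<theta> + W ^ q * \<theta> ^ q + (V ^ q) ^ q * (\<theta> ^ q) ^ q \<noteq> 0"
      using ex_trace_like_nonzero[of U "(V ^ q) ^ q" "W ^ q"] by blast
    define x where "x = U * \<theta> + W ^ q * \<theta> ^ q + (V ^ q) ^ q * (\<theta> ^ q) ^ q"
    define t1 t2 where t: "t1 = \<theta> ^ q" "t2 = t1 ^ q"
    have t2q: "t2 ^ q = \<theta>" by (simp add: t frob3)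
    define U1 U2 V1 V2 W1 W2 where d2: "U1 = U ^ q" "U2 = U1 ^ q" "V1 = V ^ q" "V2 = V1 ^ q"
      "W1 = W ^ q" "W2 = W1 ^ q"
    have d2q: "U2 ^ q = U" "V2 ^ q = V" "W2 ^ q = W" by (simp_all add: d2 frob3)
    have x0: "x = U * \<theta> + W1 * t1 + V2 * t2" by (simp add: x_def d2 t)
    have x1: "x ^ q = U1 * t1 + W2 * t2 + V * \<theta>"
      unfolding x0 by (simp add: frob_simps t2q d2q flip: d2 t)
    have x2: "(x ^ q) ^ q = U2 * t2 + W * \<theta> + V1 * t1"
    proof -
      have "(x ^ q) ^ q = U1 ^ q * t1 ^ q + W2 ^ q * t2 ^ q + V ^ q * \<theta> ^ q"
        unfolding x1 by (simp only: frob_add power_mult_distrib)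
      thus ?thesis by (simp add: t2q d2q flip: d2 t)
    qed
    note fs = frob_simps t2q d2q w2q fA
    have z: "(0::'a) ^ q = 0" using q_gt by (simp add: power_0_left)
    have f2: "A * U1 + V1 + w * W1 = 0"
      using arg_cong[OF e(3), of "\<lambda>t. t ^ q"] by (simp add: fs z algebra_simps flip: d2 w)
    have f3a: "U1 + w2 * V1 + A * W1 = 0"
      using arg_cong[OF e(2), of "\<lambda>t. t ^ q"] by (simp add: fs z algebra_simps flip: d2 w)
    have f3: "U2 + w * V2 + A * W2 = 0"
      using arg_cong[OF f3a, of "\<lambda>t. t ^ q"] by (simp add: fs z algebra_simps flip: d2 w)
    have "w * x + A * x ^ q + (x ^ q) ^ q = \<theta> * (w * U + A * V + W)
        + t1 * (A * U1 + V1 + w * W1) + t2 * (U2 + w * V2 + A * W2)"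
      unfolding x2 unfolding x1 unfolding x0 by (simp add: algebra_simps)
    also have "\<dots> = 0" by (simp only: e(1) f2 f3 mult_zero_right add_0)
    finally have "w * x + A * x ^ q + (x ^ q) ^ q = 0" .
    with \<theta> show ?lhs unfolding L by (auto simp: x_def)
  }
qed

section \<open>The pencil of cubics\<close>

text \<open>A cubic without roots in F_q is irreducible, so its roots are the conjugates x, x^q,
  x^{q^2} of an element of F_{q^3}. The root is taken in the algebraic closure and then shown to
  descend.\<close>

lemma irreducible_cubic_has_root:
  assumes K: "b \<in> Fq" "c \<in> Fq" "d \<in> Fq"
    and nr: "\<And>t. t \<in> Fq \<Longrightarrow> t ^ 3 + b * t\<^sup>2 + c * t + d \<noteq> 0"
  shows "\<exists>x. tr x = - b \<and> tr2 x = c \<and> nm x = - d"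
proof -
  let ?b = "to_ac b" and ?c = "to_ac c" and ?d = "to_ac d"
  let ?P = "\<lambda>t. t ^ 3 + ?b * t\<^sup>2 + ?c * t + ?d"
  have add: "(x + y) ^ q = x ^ q + (y :: 'a alg_closure) ^ q" for x y
    by (rule freshmans_dream') (simp_all add: CHAR_eq prime_p q_def)
  have frK: "to_ac t ^ q = to_ac t" if "t \<in> Fq" for t
    using that by (simp add: Fq_iff flip: to_ac_power)
  have z: "(0 :: 'a alg_closure) ^ q = 0" using q_gt by (simp add: power_0_left)
  have pow: "(t ^ q) ^ n = (t ^ n) ^ q" for t :: "'a alg_closure" and n
    by (simp add: mult.commute flip: power_mult)
  have P: "?P (t ^ q) = ?P t ^ q" for t
    by (simp add: add power_mult_distrib frK K pow)
  have noroot: "?P t \<noteq> 0" if "t ^ q = t" for t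
  proof -
    have "t \<in> to_ac ` Fq"
      using that power_fixed_alg_closure[OF subfield finite_Fq] by (auto simp: card_Fq)
    then obtain s where s: "s \<in> Fq" "t = to_ac s" by blast
    have "?P t = to_ac (s ^ 3 + b * s\<^sup>2 + c * s + d)" by (simp add: s(2))
    with nr[OF s(1)] show ?thesis by (simp only: to_ac_eq_0_iff not_False_eq_True)
  qed
  obtain x where "poly [:?d, ?c, ?b, 1:] x = 0"
    using alg_closed_imp_poly_has_root[of "[:?d, ?c, ?b, 1:]"] by auto
  hence x: "?P x = 0" by (simp add: algebra_simps power2_eq_square power3_eq_cube)
  define x1 where "x1 = x ^ q"
  define x2 where "x2 = x1 ^ q"
  define y where "y = - ?b - x - x1"
  have x1: "?P x1 = 0" and x2: "?P x2 = 0" unfolding x2_def x1_def P x z by simp_all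
  have ne: "x \<noteq> x1" using noroot[of x] x by (auto simp: x1_def)
  have "x + x1 + y = - ?b" by (simp add: y_def)
  note two = cubic_two_roots[OF x x1 ne this]
  have diff: "(u - v) ^ q = u ^ q - (v :: 'a alg_closure) ^ q" for u v
    using add[of "u - v" v] by simp
  \<comment> \<open>Otherwise Frobenius would swap \<open>x\<close> and \<open>x1\<close> and fix
    the third root \<open>y\<close>, which would then lie in F_q.\<close>
  have "x2 \<noteq> x"
  proof
    assume 2: "x2 = x"
    have "x + x1 + y = - ?b" by (simp add: y_def)
    hence "y = - ?b - (x + x1)" by (simp add: algebra_simps)
    moreover have "(- ?b) ^ q = - ?b" using frK[of "- b"] K(1) subfield_closed[OF subfield] by simp
    moreover have "(x + x1) ^ q = x + x1" using 2 by (simp add: add x1_def x2_def add.commute)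
    ultimately have "y ^ q = y" by (simp add: diff)
    moreover have "?P y = 0" by (simp add: two(3))
    ultimately show False using noroot by blast
  qed
  moreover have "x2 \<noteq> x1"
  proof
    assume "x2 = x1"
    hence "(x1 - x) ^ q = 0" by (simp add: diff x1_def x2_def)
    thus False using ne by simp
  qed
  moreover have "(x2 - x) * (x2 - x1) * (x2 - y) = 0" using x2 two(3)[of x2] by simp
  ultimately have "y = x2" by simp
  hence e1: "x + x1 + x2 = - ?b" and e2: "?c = x * x1 + x1 * x2 + x2 * x" and e3: "?d = - (x * x1 * x2)"
    using two(1,2) by (simp_all add: y_def algebra_simps)
  \<comment> \<open>The sum of the three roots is Frobenius-invariant, which closes the orbit:
    \<open>x2 ^ q = x\<close>.\<close>
  have "(- ?b) ^ q = - ?b" using frK[of "- b"] K(1) subfield_closed[OF subfield] by simp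
  hence "(x + x1 + x2) ^ q = x + x1 + x2" by (simp add: e1)
  hence "x2 ^ q = x" by (simp add: add flip: x1_def x2_def)
  hence "x ^ card (UNIV :: 'a set) = x"
    by (simp add: card_UNIV power3_eq_cube x1_def x2_def flip: power_mult)
  hence "x \<in> range to_ac" using power_fixed_alg_closure[OF is_subfield_UNIV finite] by blast
  then obtain r where r: "x = to_ac r" by blast
  have x12: "x1 = to_ac (r ^ q)" "x2 = to_ac ((r ^ q) ^ q)" by (simp_all add: x1_def x2_def r)
  have "to_ac (tr r) = to_ac (- b)" using e1 by (simp add: tr_def r x12)
  moreover have "to_ac (tr2 r) = to_ac c" using e2 by (simp add: tr2_def r x12)
  moreover have "to_ac (nm r) = to_ac (- d)" using e3 by (simp add: nm_def r x12)
  ultimately show ?thesis unfolding to_ac_eq_iff by blast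
qed

lemma tr_Fq: "x \<in> Fq \<Longrightarrow> tr x = 3 * x" "x \<in> Fq \<Longrightarrow> tr2 x = 3 * x\<^sup>2" "x \<in> Fq \<Longrightarrow> nm x = x ^ 3"
  by (simp_all add: Fq_iff tr_def tr2_def nm_def power2_eq_square power3_eq_cube)

text \<open>The elements sought are roots of cubics $T^3 - s T^2 - E T + m s$ that are irreducible or a cube
  over $\mathbb{F}_q$. The discriminant of such a cubic is $4 m s^4 + \beta s^2 + \gamma$ with $\beta$, $\gamma$
  as defined in the proof.\<close>

lemma ex_tr2_nm_eq:
  assumes K: "m \<in> Fq" "E \<in> Fq" and m0: "m \<noteq> 0" and Em: "E \<noteq> m"
    and E9: "E = 9 * m \<Longrightarrow> \<exists>r\<in>Fq. r\<^sup>2 = m \<or> r\<^sup>2 = - 3 * m"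
  shows "\<exists>c. tr2 c = - E \<and> nm c = - m * tr c"
proof (rule ccontr)
  assume no: "\<not> ?thesis"
  note cl = subfield_closed[OF subfield]
  \<comment> \<open>A solution inside F_q corresponds to a cubic of the form (T - a)^3.\<close>
  have nocube: "\<not> (3 * a\<^sup>2 = - E \<and> a ^ 3 = - 3 * m * a)" if "a \<in> Fq" for a
  proof
    assume a: "3 * a\<^sup>2 = - E \<and> a ^ 3 = - 3 * m * a"
    have "tr2 a = - E \<and> nm a = - m * tr a" using a by (simp add: tr_Fq[OF that])
    thus False using no by blast
  qed
  let ?P = "\<lambda>s t. t ^ 3 - s * t\<^sup>2 - E * t + m * s"
  \<comment> \<open>The fibre of \<open>R\<close> over s consists of the roots of the cubic with
    parameter s. Numerator and denominator have no common zero because \<open>m\<close> is nonzero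
    and \<open>E \<noteq> m\<close>.\<close>
  define R where "R t = (t ^ 3 - E * t) / (t\<^sup>2 - m)" for t
  have root: "\<exists>t\<in>Fq. ?P s t = 0" if s: "s \<in> Fq" for s
  proof (rule ccontr)
    assume "\<not> ?thesis"
    hence "t ^ 3 + (- s) * t\<^sup>2 + (- E) * t + m * s \<noteq> 0" if "t \<in> Fq" for t using that by simp
    moreover have "- s \<in> Fq" "- E \<in> Fq" "m * s \<in> Fq" using s K by (auto intro: cl)
    ultimately obtain x where "tr x = - (- s)" "tr2 x = - E" "nm x = - (m * s)"
      using irreducible_cubic_has_root[of "- s" "- E" "m * s"] by blast
    thus False using no by auto
  qed
  have den: "t\<^sup>2 \<noteq> m" if "?P s t = 0" for s t
  proof
    assume t: "t\<^sup>2 = m"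
    have "t * (m - E) = ?P s t" unfolding t[symmetric]
      by (simp add: power2_eq_square power3_eq_cube algebra_simps)
    with that Em have "t = 0" by simp
    with t m0 show False by simp
  qed
  have R: "?P s t = 0 \<longleftrightarrow> R t = s" if "t\<^sup>2 \<noteq> m" for s t
  proof -
    have "?P s t = 0 \<longleftrightarrow> t ^ 3 - E * t = s * (t\<^sup>2 - m)" by (auto simp: algebra_simps)
    also have "\<dots> \<longleftrightarrow> R t = s" using that by (simp add: R_def nonzero_divide_eq_eq)
    finally show ?thesis .
  qed
  let ?D = "{t \<in> Fq. t\<^sup>2 \<noteq> m}"
  have onto: "Fq \<subseteq> R ` ?D"
  proof
    fix s assume "s \<in> Fq"
    from root[OF this] obtain t where t: "t \<in> Fq" "?P s t = 0" by blast
    hence "t\<^sup>2 \<noteq> m" "R t = s" using den R by blast+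
    thus "s \<in> R ` ?D" using t(1) by blast
  qed
  \<comment> \<open>A subset of F_q that maps onto F_q is all of F_q. So t^2 - m has no zero in F_q,
    and \<open>R\<close> is injective there: each cubic has exactly one root in F_q.\<close>
  have "card Fq \<le> card (R ` ?D)" by (rule card_mono[OF _ onto]) simp
  also have "\<dots> \<le> card ?D" by (rule card_image_le) simp
  finally have "?D = Fq" by (intro card_seteq) auto
  hence msq: "t\<^sup>2 \<noteq> m" if "t \<in> Fq" for t using that by blast
  have "R ` Fq = Fq"
    using onto \<open>?D = Fq\<close> by (intro card_seteq[symmetric]) (auto intro: card_image_le)
  hence inj: "inj_on R Fq" by (intro eq_card_imp_inj_on) auto
  have uniq: "t = t'" if "t \<in> Fq" "t' \<in> Fq" "?P s t = 0" "?P s t' = 0" for s t t'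
    using that R msq inj by (metis inj_onD)

  define \<beta> where "\<beta> = E\<^sup>2 + 18 * E * m - 27 * m\<^sup>2"
  define \<gamma> where "\<gamma> = 4 * E ^ 3"
  \<comment> \<open>This is the case in which the conic degenerates. As \<open>m\<close> is a
    nonsquare, \<open>E9\<close> gives a square root of -3m, and this is a solution inside
    F_q.\<close>
  have "E \<noteq> 9 * m"
  proof
    assume E: "E = 9 * m"
    then obtain r where r: "r \<in> Fq" "r\<^sup>2 = - 3 * m" using E9 msq by blast
    have "3 * r\<^sup>2 = - E" unfolding r(2) E by simp
    moreover have "r ^ 3 = - 3 * m * r" using r(2) by (simp add: power3_eq_cube power2_eq_square)
    ultimately show False using nocube[OF r(1)] by blast
  qed
  moreover have "\<beta>\<^sup>2 - 16 * m * \<gamma> = (E - m) * (E - 9 * m) ^ 3"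
    by (simp add: \<beta>_def \<gamma>_def power2_eq_square power3_eq_cube algebra_simps)
  ultimately have "\<beta>\<^sup>2 \<noteq> 16 * m * \<gamma>" using Em by auto
  moreover have "\<beta> \<in> Fq" "\<gamma> \<in> Fq" using K by (auto simp: \<beta>_def \<gamma>_def intro!: cl)
  ultimately obtain s z where sz: "s \<in> Fq" "z \<in> Fq" "z\<^sup>2 = 4 * m * s ^ 4 + \<beta> * s\<^sup>2 + \<gamma>"
    using ex_biquadratic_square[OF subfield finite_Fq two_nz K(1) msq] by metis
  obtain a where a: "a \<in> Fq" "?P s a = 0" using root[OF sz(1)] by blast
  \<comment> \<open>Now the discriminant of the cubic is the square z^2. \<open>\<alpha>\<close> and
    \<open>\<delta>\<close> are the coefficients of the quadratic cofactor of T - a, and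
    \<open>g\<close> is the value of this cofactor at a.\<close>
  define \<alpha> where "\<alpha> = a - s"
  define \<delta> where "\<delta> = a\<^sup>2 - s * a - E"
  define g where "g = 3 * a\<^sup>2 - 2 * s * a - E"
  have fac: "?P s t = (t - a) * (t\<^sup>2 + \<alpha> * t + \<delta>)" for t
  proof -
    have "?P s t - (t - a) * (t\<^sup>2 + \<alpha> * t + \<delta>) = ?P s a"
      by (simp add: \<alpha>_def \<delta>_def power2_eq_square power3_eq_cube algebra_simps)
    thus ?thesis using a(2) by simp
  qed
  have ms: "m * s = - (a * \<delta>)" using fac[of 0] by simp
  have E: "E = a\<^sup>2 - s * a - \<delta>" by (simp add: \<delta>_def)
  have disc: "z\<^sup>2 = (\<alpha>\<^sup>2 - 4 * \<delta>) * g\<^sup>2"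
  proof -
    have "z\<^sup>2 = 4 * (m * s) * s ^ 3 + E\<^sup>2 * s\<^sup>2 + 18 * E * (m * s) * s - 27 * (m * s)\<^sup>2 + 4 * E ^ 3"
      unfolding sz(3) \<beta>_def \<gamma>_def
      by (simp add: power2_eq_square power3_eq_cube power4_eq_xxxx algebra_simps)
    also have "\<dots> = (\<alpha>\<^sup>2 - 4 * \<delta>) * g\<^sup>2"
      unfolding ms g_def \<alpha>_def unfolding E
      by (simp add: power2_eq_square power3_eq_cube algebra_simps)
    finally show ?thesis .
  qed
  show False
  proof (cases "g = 0")
    case True
    \<comment> \<open>Here \<open>a\<close> is a double root and \<open>b\<close> the remaining one.
      Uniqueness makes \<open>a\<close> a triple root, against \<open>nocube\<close>.\<close>
    define b where "b = s - 2 * a"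
    have "b\<^sup>2 + \<alpha> * b + \<delta> = g"
      by (simp add: b_def \<alpha>_def \<delta>_def g_def power2_eq_square algebra_simps)
    hence "?P s b = 0" using fac[of b] True by simp
    moreover have "b \<in> Fq" using a sz by (auto simp: b_def intro!: cl)
    ultimately have "b = a" using uniq a by blast
    hence s: "s = 3 * a" by (simp add: b_def algebra_simps)
    have "3 * a\<^sup>2 + E = - g" unfolding g_def s by (simp add: power2_eq_square algebra_simps)
    hence E: "3 * a\<^sup>2 = - E" using True by (simp add: eq_neg_iff_add_eq_0)
    have "a ^ 3 + 3 * m * a = ?P s a + (E + 3 * a\<^sup>2) * a"
      unfolding s by (simp add: power2_eq_square power3_eq_cube algebra_simps)
    hence "a ^ 3 = - 3 * m * a" unfolding a(2) E by (simp add: eq_neg_iff_add_eq_0)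
    with E nocube[OF a(1)] show False by blast
  next
    case False
    \<comment> \<open>\<open>w\<close> is a square root of the discriminant of the quadratic
      cofactor, so the quadratic formula gives a root in F_q. By uniqueness it equals
      \<open>a\<close>, which would make \<open>g\<close> zero.\<close>
    define w where "w = z / g"
    define b where "b = (w - \<alpha>) / 2"
    have gK: "g \<in> Fq" "\<alpha> \<in> Fq" using a sz K by (auto simp: g_def \<alpha>_def intro!: cl)
    hence bK: "b \<in> Fq" using sz by (auto simp: b_def w_def intro!: cl)
    have "2 * b = w - \<alpha>"
      unfolding b_def times_divide_eq_right by (rule nonzero_mult_div_cancel_left[OF two_nz])
    hence w: "w = 2 * b + \<alpha>" by simp
    have "w\<^sup>2 = \<alpha>\<^sup>2 - 4 * \<delta>" using disc False by (simp add: w_def power_divide)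
    hence "2 * 2 * (b\<^sup>2 + \<alpha> * b + \<delta>) = 0"
      unfolding w by (simp add: power2_eq_square algebra_simps)
    hence b0: "b\<^sup>2 + \<alpha> * b + \<delta> = 0" using two_nz by (metis mult_eq_0_iff)
    hence "?P s b = 0" using fac[of b] by simp
    hence "b = a" using uniq bK a by blast
    hence "g = 0" using b0 by (simp add: g_def \<alpha>_def \<delta>_def power2_eq_square algebra_simps)
    with False show False by simp
  qed
qed

section \<open>The classification\<close>

lemma det_shift:
  assumes "B \<in> Fq"
  shows "nm (B - c) = B ^ 3 - B\<^sup>2 * tr c + B * tr2 c - nm c" "tr (B - c) = 3 * B - tr c"
  using assms by (simp_all add: Fq_iff nm_def tr_def tr2_def frob_diff power2_eq_square
      power3_eq_cube algebra_simps)

lemma sym_minus: "tr (- c) = - tr c" "tr2 (- c) = tr2 c" "nm (- c) = - nm c"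
  by (simp_all add: tr_def tr2_def nm_def frob_minus)

text \<open>$xL(y) + yL(x) = 0$ says that $c = L(x)/x$ and $-c = L(y)/y$ are both eigenvalues; the two
  displayed equations are the even and the odd part in $c$ of the characteristic equation.\<close>

lemma planar_f_AB_iff_tr:
  assumes A: "A \<in> Fq" and B: "B \<in> Fq"
  shows "planar (poly (f_AB q A B)) \<longleftrightarrow>
    \<not> (\<exists>c. B ^ 3 + A ^ 3 + 1 - 3 * A * B + B * tr2 c = 0 \<and> nm c + (B\<^sup>2 - A) * tr c = 0)"
proof -
  let ?d = "\<lambda>c. nm (B - c) - A * tr (B - c) + A ^ 3 + 1"
  let ?e = "\<lambda>c. B ^ 3 + A ^ 3 + 1 - 3 * A * B + B * tr2 c"
  let ?o = "\<lambda>c. nm c + (B\<^sup>2 - A) * tr c"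
  note ev = eigenvalue_iff[OF A B]
  have "planar (poly (f_AB q A B)) \<longleftrightarrow>
      \<not> (\<exists>c. (\<exists>x. x \<noteq> 0 \<and> L A B x = c * x) \<and> (\<exists>y. y \<noteq> 0 \<and> L A B y = - c * y))"
    (is "_ \<longleftrightarrow> \<not> ?ex")
  proof -
    have "(\<exists>x y. x \<noteq> 0 \<and> y \<noteq> 0 \<and> x * L A B y + y * L A B x = 0) \<longleftrightarrow> ?ex"
    proof
      assume "\<exists>x y. x \<noteq> 0 \<and> y \<noteq> 0 \<and> x * L A B y + y * L A B x = 0"
      then obtain x y where xy: "x \<noteq> 0" "y \<noteq> 0" "x * L A B y + y * L A B x = 0" by blast
      define c where "c = L A B x / x"
      have x: "L A B x = c * x" using xy by (simp add: c_def)
      have "x * (L A B y + c * y) = 0" using xy(3) unfolding x by (simp add: algebra_simps)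
      hence "L A B y = - c * y" using xy(1) by (simp add: eq_neg_iff_add_eq_0)
      with x xy show ?ex by blast
    next
      assume ?ex
      then obtain c x y where "x \<noteq> 0" "L A B x = c * x" "y \<noteq> 0" "L A B y = - c * y" by blast
      moreover from this have "x * L A B y + y * L A B x = 0" by simp
      ultimately show "\<exists>x y. x \<noteq> 0 \<and> y \<noteq> 0 \<and> x * L A B y + y * L A B x = 0" by blast
    qed
    thus ?thesis unfolding planar_f_AB_iff by blast
  qed
  also have "?ex \<longleftrightarrow> (\<exists>c. ?d c = 0 \<and> ?d (- c) = 0)" unfolding ev ..
  also have "\<dots> \<longleftrightarrow> (\<exists>c. ?e c = 0 \<and> ?o c = 0)"
  proof (rule ex_cong1)
    fix c
    have d: "?d c = ?e c - ?o c" "?d (- c) = ?e c + ?o c"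
      unfolding det_shift[OF B] sym_minus by (simp_all add: algebra_simps power2_eq_square)
    have "e - d = 0 \<and> e + d = 0 \<longleftrightarrow> e = 0 \<and> d = 0" for e d :: 'a
    proof
      assume h: "e - d = 0 \<and> e + d = 0"
      have "2 * d = (e + d) - (e - d)" by (simp only: mult_2) simp
      also have "\<dots> = 0" using h by (simp only: diff_self)
      finally have "d = 0" using two_nz by simp
      with h show "e = 0 \<and> d = 0" by simp
    qed simp
    thus "?d c = 0 \<and> ?d (- c) = 0 \<longleftrightarrow> ?e c = 0 \<and> ?o c = 0" unfolding d .
  qed
  finally show ?thesis .
qed

lemma nm_eq_0_iff: "nm c = 0 \<longleftrightarrow> c = 0"
  using q_gt by (simp add: nm_def)

text \<open>Frobenius has odd order dividing 3, so applying x^q = -x three times gives x =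
  -x.\<close>

lemma add_frob_eq_0:
  assumes "x + x ^ q = (0::'a)"
  shows "x = 0"
proof -
  have 1: "x ^ q = - x" using assms by (simp add: eq_neg_iff_add_eq_0 add.commute)
  have "x = ((x ^ q) ^ q) ^ q" by (simp add: frob3)
  also have "\<dots> = - x" by (simp add: 1 frob_minus)
  finally have "x + x = 0" by (simp add: eq_neg_iff_add_eq_0)
  hence "2 * x = 0" by (simp only: mult_2)
  thus "x = 0" using two_nz by simp
qed

text \<open>e1 e2 - e3 is the product of the pairwise sums of the conjugates, so one of these sums
  vanishes.\<close>

lemma nm_eq_tr2_tr_imp:
  assumes "nm c = tr2 c * tr c"
  shows "c = 0"
proof -
  have "(c + c ^ q) * (c ^ q + (c ^ q) ^ q) * ((c ^ q) ^ q + c) = tr2 c * tr c - nm c"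
    by (simp add: nm_def tr_def tr2_def algebra_simps)
  hence "c + c ^ q = 0 \<or> c ^ q + (c ^ q) ^ q = 0 \<or> (c ^ q) ^ q + ((c ^ q) ^ q) ^ q = 0"
    using assms by (auto simp: frob3)
  hence "c = 0 \<or> c ^ q = 0 \<or> (c ^ q) ^ q = 0" using add_frob_eq_0 by blast
  thus ?thesis by auto
qed

text \<open>Treats the degenerate case E = 9m. The left-hand side is X^3 + Y^3 + Z^3 - 3XYZ at (A,
  -2B, 1), which has the factor X + Y + Z.\<close>

lemma special_square:
  assumes A: "A \<in> Fq" and B: "B \<in> Fq" and eq: "A ^ 3 - 8 * B ^ 3 + 1 + 6 * A * B = 0"
  shows "\<exists>r\<in>Fq. r\<^sup>2 = B\<^sup>2 - A \<or> r\<^sup>2 = - 3 * (B\<^sup>2 - A)"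
proof -
  note cl = subfield_closed[OF subfield]
  let ?f = "A\<^sup>2 + 4 * B\<^sup>2 + 1 + 2 * A * B + 2 * B - A"
  have four: "(4::'a) = 2 * 2" by simp
  have n4: "(4::'a) \<noteq> 0" unfolding four by (intro no_zero_divisors two_nz)
  have "(A - 2 * B + 1) * ?f = A ^ 3 - 8 * B ^ 3 + 1 + 6 * A * B"
    by (simp add: power2_eq_square power3_eq_cube algebra_simps)
  hence "A - 2 * B + 1 = 0 \<or> ?f = 0" using eq by simp
  thus ?thesis
  proof
    assume "A - 2 * B + 1 = 0"
    hence A': "A = 2 * B - 1" by (simp add: algebra_simps)
    have "(B - 1)\<^sup>2 = B\<^sup>2 - A" unfolding A' by (simp add: power2_eq_square algebra_simps)
    thus ?thesis using cl(7)[OF B cl(2)] by blast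
  next
    assume f: "?f = 0"
    \<comment> \<open>The second factor is, up to 4, a norm form for sqrt(-3); unless both squares
      vanish, its zero produces a square root of -3 in F_q.\<close>
    have sq: "(2 * A + 2 * B - 1)\<^sup>2 + 3 * (2 * B + 1)\<^sup>2 = 4 * ?f"
      by (simp add: power2_eq_square algebra_simps)
    show ?thesis
    proof (cases "2 * B + 1 = 0")
      case True
      hence B2: "2 * B = - 1" by (simp add: eq_neg_iff_add_eq_0)
      have "(2 * A + 2 * B - 1)\<^sup>2 = 0" using sq f True by simp
      hence "2 * A - 2 = 0" using B2 by (simp add: algebra_simps)
      hence "2 * (A - 1) = 0" by (simp add: algebra_simps)
      hence A1: "A = 1" using two_nz by simp
      have "2 * 2 * B\<^sup>2 = (2 * B)\<^sup>2" by (simp add: power2_eq_square)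
      hence B4: "4 * B\<^sup>2 = 1" by (simp add: B2)
      have "4 * (3 * B)\<^sup>2 = 9 * (4 * B\<^sup>2)" by (simp add: power2_eq_square)
      moreover have "4 * (- 3 * (B\<^sup>2 - A)) = - 3 * (4 * B\<^sup>2) + 12" by (simp add: A1 algebra_simps)
      ultimately have "4 * (3 * B)\<^sup>2 = 4 * (- 3 * (B\<^sup>2 - A))" by (simp add: B4)
      hence "(3 * B)\<^sup>2 = - 3 * (B\<^sup>2 - A)" using n4 mult_left_cancel by blast
      thus ?thesis using cl(4)[OF cl(10) B] by blast
    next
      case False
      define r where "r = (2 * A + 2 * B - 1) / (2 * B + 1)"
      have r: "r * (2 * B + 1) = 2 * A + 2 * B - 1" using False by (simp add: r_def)
      have "(2 * B + 1)\<^sup>2 * (r\<^sup>2 + 3) = (r * (2 * B + 1))\<^sup>2 + 3 * (2 * B + 1)\<^sup>2"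
        by (simp add: power2_eq_square algebra_simps)
      also have "\<dots> = 0" unfolding r sq f by simp
      finally have r2: "r\<^sup>2 + 3 = 0" using False by simp
      \<comment> \<open>Since r^2 = -3, the relation between A and B makes 4 (B^2 - A) equal to (2B
        + 1 - r)^2.\<close>
      define t where "t = (2 * B + 1 - r) / 2"
      have t: "2 * t = 2 * B + 1 - r"
        unfolding t_def times_divide_eq_right by (rule nonzero_mult_div_cancel_left[OF two_nz])
      have "4 * t\<^sup>2 = (2 * t)\<^sup>2" by (simp add: power2_eq_square)
      also have "\<dots> = (2 * B + 1)\<^sup>2 - 2 * (r * (2 * B + 1)) + (r\<^sup>2 + 3) - 3"
        unfolding t by (simp add: power2_eq_square algebra_simps)
      also have "\<dots> = 4 * (B\<^sup>2 - A)" unfolding r r2 by (simp add: power2_eq_square algebra_simps)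
      finally have "t\<^sup>2 = B\<^sup>2 - A" using n4 mult_left_cancel by blast
      moreover have "t \<in> Fq" using A B by (auto simp: t_def r_def intro!: cl)
      ultimately show ?thesis by blast
    qed
  qed
qed

lemma planar_f_AB_classification:
  assumes A: "A \<in> Fq" and B: "B \<in> Fq"
  shows "planar (poly (f_AB q A B)) \<longleftrightarrow>
           (A ^ 3 - 2 * A * B + 1 = 0 \<and> A ^ 3 \<noteq> 1 \<and> A ^ 3 \<noteq> - 1)
         \<or> (A = B ^ 2 \<and> B ^ 3 \<noteq> 1)
         \<or> (B = 0 \<and> A ^ 3 + 1 \<noteq> 0)" (is "_ \<longleftrightarrow> ?i \<or> ?ii \<or> ?iii")
proof -
  note cl = subfield_closed[OF subfield]
  let ?h = "B ^ 3 + A ^ 3 + 1 - 3 * A * B"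
  let ?sol = "\<lambda>c. ?h + B * tr2 c = 0 \<and> nm c + (B\<^sup>2 - A) * tr c = 0"
  note iff = planar_f_AB_iff_tr[OF A B]
  have sol0: "?sol 0 \<longleftrightarrow> ?h = 0" using q_gt by (simp add: tr_def tr2_def nm_def power_0_left)
  show ?thesis
  proof (cases "B = 0")
    case True
    \<comment> \<open>For B = 0 the first equation no longer involves c, and c = 0 satisfies the
      second.\<close>
    have "(\<exists>c. ?sol c) \<longleftrightarrow> A ^ 3 + 1 = 0" using sol0 by (auto simp: True)
    hence pl: "planar (poly (f_AB q A B)) \<longleftrightarrow> A ^ 3 + 1 \<noteq> 0" unfolding iff by simp
    have "?ii \<Longrightarrow> A ^ 3 + 1 \<noteq> 0" using True by simp
    moreover have "?i \<Longrightarrow> A ^ 3 + 1 \<noteq> 0" by (simp add: eq_neg_iff_add_eq_0)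
    ultimately show ?thesis using pl True by blast
  next
    case B0: False
    show ?thesis
    proof (cases "A = B\<^sup>2")
      case True
      have A3: "A ^ 3 = (B ^ 3)\<^sup>2" by (simp add: True flip: power_mult)
      have AB: "A * B = B ^ 3" by (simp add: True power2_eq_square power3_eq_cube)
      have h: "?h = (B ^ 3 - 1)\<^sup>2"
      proof -
        have "?h = B ^ 3 + (B ^ 3)\<^sup>2 + 1 - 3 * (A * B)" by (simp add: A3 mult.assoc)
        thus ?thesis unfolding AB by (simp add: power2_diff)
      qed
      have "(\<exists>c. ?sol c) \<longleftrightarrow> ?h = 0"
      proof
        assume "\<exists>c. ?sol c"
        then obtain c where c: "?sol c" by blast
        hence "c = 0" using True by (simp add: nm_eq_0_iff)
        thus "?h = 0" using c sol0 by blast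
      qed (use sol0 in blast)
      hence pl: "planar (poly (f_AB q A B)) \<longleftrightarrow> B ^ 3 \<noteq> 1" unfolding iff h by simp
      \<comment> \<open>On the curve A = B^2, condition (i) therefore implies (ii).\<close>
      have "A ^ 3 = 1" if "B ^ 3 = 1" unfolding A3 that by simp
      thus ?thesis using pl True B0 by blast
    next
      case AB: False
      define m where "m = B\<^sup>2 - A"
      have m0: "m \<noteq> 0" using AB by (simp add: m_def)
      have mK: "m \<in> Fq" using A B by (auto simp: m_def intro!: cl)
      show ?thesis
      proof (cases "A ^ 3 - 2 * A * B + 1 = 0")
        case True
        \<comment> \<open>The equation in (i) says that E = m. Then e2 = -m and e3 = -m e1, so e3 =
          e1 e2, which forces c = 0 and m = 0.\<close>
        have h: "?h = B * m"
        proof -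
          have "?h = (A ^ 3 - 2 * A * B + 1) + B * m"
            by (simp add: m_def power2_eq_square power3_eq_cube algebra_simps)
          thus ?thesis using True by simp
        qed
        have "\<not> ?sol c" for c
        proof
          assume c: "?sol c"
          hence "B * (m + tr2 c) = 0" unfolding h by (simp add: algebra_simps)
          hence t2: "tr2 c = - m" using B0 by (simp add: eq_neg_iff_add_eq_0 add.commute)
          have "nm c + m * tr c = 0" using c by (simp only: m_def)
          hence "nm c = tr2 c * tr c" unfolding t2 by (simp add: eq_neg_iff_add_eq_0)
          hence "c = 0" by (rule nm_eq_tr2_tr_imp)
          hence "m = 0" using t2 q_gt by (simp add: tr2_def power_0_left)
          with m0 show False by blast
        qed
        hence pl: "planar (poly (f_AB q A B))" unfolding iff by blast
        have "A ^ 3 \<noteq> 1"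
        proof
          assume A3: "A ^ 3 = 1"
          hence "2 * (1 - A * B) = 0" using True by (simp add: algebra_simps)
          hence "A * B = 1" using two_nz by simp
          hence "A = A ^ 3 * B\<^sup>2" by (simp add: power2_eq_square power3_eq_cube algebra_simps)
          with A3 AB show False by simp
        qed
        moreover have "A ^ 3 \<noteq> - 1"
        proof
          assume A3: "A ^ 3 = - 1"
          hence "A * B = 0" using True two_nz by (simp add: mult.assoc)
          hence "A = 0" using B0 by simp
          with A3 show False by simp
        qed
        ultimately show ?thesis using pl True by blast
      next
        case False
        \<comment> \<open>Chosen so that the first equation reads \<open>tr2 c = - E\<close>;
          failure of the equation in (i) becomes \<open>E \<noteq> m\<close>.\<close>
        define E where "E = ?h / B"
        have EB: "E * B = ?h" using B0 by (simp add: E_def)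
        have EK: "E \<in> Fq" using A B by (auto simp: E_def intro!: cl)
        have "(E - m) * B = A ^ 3 - 2 * A * B + 1"
          unfolding left_diff_distrib EB
          by (simp add: m_def power2_eq_square power3_eq_cube algebra_simps)
        hence Em: "E \<noteq> m" using False by auto
        have E9: "\<exists>r\<in>Fq. r\<^sup>2 = m \<or> r\<^sup>2 = - 3 * m" if E: "E = 9 * m"
          unfolding m_def
        proof (rule special_square[OF A B])
          have "A ^ 3 - 8 * B ^ 3 + 1 + 6 * A * B = (E - 9 * m) * B"
            unfolding left_diff_distrib EB
            by (simp add: m_def power2_eq_square power3_eq_cube algebra_simps)
          thus "A ^ 3 - 8 * B ^ 3 + 1 + 6 * A * B = 0" using E by simp
        qed
        obtain c where c: "tr2 c = - E" "nm c = - m * tr c"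
          using ex_tr2_nm_eq[OF mK EK m0 Em E9] by blast
        have "?sol c" unfolding c EB[symmetric] by (simp add: m_def algebra_simps)
        hence "\<not> planar (poly (f_AB q A B))" unfolding iff by blast
        thus ?thesis using B0 AB False by simp
      qed
    qed
  qed
qed

end

theorem theorem2p5:
  fixes p k q :: nat
    and Fq :: "'a::{finite, field} set"
    and A B :: 'a
  assumes "prime p" and "odd p" and "k \<ge> 1" and "q = p ^ k"
    and "card (UNIV :: 'a set) = q ^ 3"
    and "is_subfield Fq" and "card Fq = q"
    and "A \<in> Fq" and "B \<in> Fq"
  shows "planar (poly (f_AB q A B)) \<longleftrightarrow>
           (A ^ 3 - 2 * A * B + 1 = 0 \<and> A ^ 3 \<noteq> 1 \<and> A ^ 3 \<noteq> - 1)
         \<or> (A = B ^ 2 \<and> B ^ 3 \<noteq> 1)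
         \<or> (B = 0 \<and> A ^ 3 + 1 \<noteq> 0)"
proof -
  interpret cubic_extension p k q Fq
    by unfold_locales (rule assms)+
  show ?thesis by (rule planar_f_AB_classification[OF assms(8,9)])
qed

end
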